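(* Let $j\in\{2,3,4\}$, $\lambda\in\{1,-1\}$, let $r>0$ be constant, and let $\beta$ be a unit-speed spacelike curve in $\mathbb{E}^4_1$ with non-null Frenet frame $\{F_1,F_2,F_3,F_4\}$ whose timelike member is $F_j$. Let $M$ be the tubular hypersurface $$\mathcal{T}^{\{j,\lambda\}}(s,t,w)=\beta(s)+r\sum_{i=2}^4\mu_i^{\lambda}F_i(s)$$ with Gauss map $N^{\{j,\lambda\}}=-(-1)^{(4-j)!}\lambda^j\sum_{i=2}^4\mu_i^\lambda F_i$. Then $M$ does not have second kind $\mathcal{L}_1$-pointwise 1-type Gauss map; that is, there do not exist a non-zero smooth function $\mathfrak{m}$ on $M$ and a non-zero constant vector $C\in\mathbb{E}^4_1$ such that $\mathcal{L}_1N^{\{j,\lambda\}}=\mathfrak{m}(N^{\{j,\lambda\}}+C)$.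
   Context: $\mathbb{E}^4_1$ is $\mathbb{R}^4$ with the metric $\langle\ ,\ \rangle=-dx_1^2+dx_2^2+dx_3^2+dx_4^2$. The curve $\beta:I\to\mathbb{E}^4_1$ ($I$ an open interval) is smooth with $\beta'=F_1$, and $\{F_1,\dots,F_4\}$ is a smooth orthonormal frame along $\beta$ with $\langle F_j,F_j\rangle=-1$ and $\langle F_i,F_i\rangle=1$ for $i\neq j$, satisfying, with smooth curvature functions $k_1,k_2,k_3$ of $s$, the Frenet equations - $j=2$: $F_1'=k_1F_2$, $F_2'=k_1F_1+k_2F_3$, $F_3'=k_2F_2+k_3F_4$, $F_4'=-k_3F_3$; - $j=3$: $F_1'=k_1F_2$, $F_2'=-k_1F_1+k_2F_3$, $F_3'=k_2F_2+k_3F_4$, $F_4'=k_3F_3$; - $j=4$: $F_1'=k_1F_2$, $F_2'=-k_1F_1+k_2F_3$, $F_3'=-k_2F_2+k_3F_4$, $F_4'=k_3F_3$. The functions $\mu_i^\lambda$ (depending on $j$) are given by $\mu_j^\lambda=(\sinh w)^{\frac{1+\lambda}2}(\cosh w)^{\frac{1-\lambda}2}\cosh t$, $\mu_{j+1}^\lambda=(\sinh w)^{\frac{1-\lambda}2}(\cosh w)^{\frac{1+\lambda}2}$, $\mu_{j+2}^\lambda=(\sinh w)^{\frac{1+\lambda}2}(\cosh w)^{\frac{1-\lambda}2}\sinh t$, with the index convention $\mu_5^\lambda=\mu_2^\lambda$, $\mu_6^\lambda=\mu_3^\lambda$. ($\lambda=1$: envelope of pseudo hyperspheres; $\lambda=-1$: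 envelope of pseudo hyperbolic hyperspheres, of radius $r$ centered on $\beta$.) The parameters $(s,t,w)$ range over a connected open set $U\subset I\times\mathbb{R}^2$ projecting onto $I$ on which $\mathcal{T}^{\{j,\lambda\}}$ is an immersion, i.e. $(\mu_{j+1}^\lambda)_w\neq0$ and $1+(-1)^{(4-j)!}rk_1\mu_2^\lambda\neq0$. The unit normal $N=N^{\{j,\lambda\}}$ has $\varepsilon=\langle N,N\rangle=\lambda$, and the principal curvatures with respect to $N$ (eigenvalues of $-dN$) are $\kappa_1=\kappa_2=\frac{(-1)^{(4-j)!}\lambda^j}{r}$, $\kappa_3=\frac{k_1\mu_2^\lambda}{\lambda^j(1+(-1)^{(4-j)!}rk_1\mu_2^\lambda)}$. Operator $\mathcal{L}_1$ (Cheng–Yau) on the Gauss map: put $a_1=-\sum_i\kappa_i$, $a_k=(-1)^k\sum_{i_1<\dots<i_k}\kappa_{i_1}\cdots\kappa_{i_k}$ ($k=2,3$), and define $H_k$ by $\binom{3}{k}H_k=(-\varepsilon)^ka_k$. Then $$\mathcal{L}_1N=-\varepsilon\,\mathfrak{C}_1\big(\nabla H_2+(3H_1H_2-H_3)N\big),\qquad \mathfrak{C}_1=\binom32(-\varepsilon)=-3\varepsilon,$$ where $\nabla$ is the gradient on $M$ with respect to the induced metric, viewed as an $\mathbb{E}^4_1$-valued map. "Non-zero function" means not identically zero. *)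

theory Defs
  imports "HOL-Analysis.Analysis"
begin

section \<open>Smooth maps and the Lorentzian product\<close>

text \<open>\<open>Ck_on n U f\<close>: \<open>f\<close> is of class \<open>C^n\<close> on the open set \<open>U\<close>.\<close>

fun Ck_on :: "nat \<Rightarrow> 'a::real_normed_vector set \<Rightarrow> ('a \<Rightarrow> 'b::real_normed_vector) \<Rightarrow> bool" where
  "Ck_on 0 U f \<longleftrightarrow> continuous_on U f"
| "Ck_on (Suc n) U f \<longleftrightarrow>
     (\<forall>x\<in>U. f differentiable (at x)) \<and> (\<forall>v. Ck_on n U (\<lambda>x. frechet_derivative f (at x) v))"

definition smooth_on :: "'a::real_normed_vector set \<Rightarrow> ('a \<Rightarrow> 'b::real_normed_vector) \<Rightarrow> bool" where
  "smooth_on U f \<longleftrightarrow> (\<forall>n. Ck_on n U f)"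

definition lprod :: "real^4 \<Rightarrow> real^4 \<Rightarrow> real" where
  "lprod x y = - (x $ 1 * y $ 1) + x $ 2 * y $ 2 + x $ 3 * y $ 3 + x $ 4 * y $ 4"


section \<open>Parametrized hypersurfaces\<close>

text \<open>
  A hypersurface is given by an immersion \<open>x\<close> of an open set of \<open>real^3\<close>; objects on the
  hypersurface are functions of the parameters, and linear operators on tangent spaces are
  matrices with respect to the coordinate basis (column \<open>b\<close> is the image of the \<open>b\<close>-th
  coordinate field).
\<close>

definition pd :: "3 \<Rightarrow> (real^3 \<Rightarrow> 'b::real_normed_vector) \<Rightarrow> real^3 \<Rightarrow> 'b" where
  "pd a f p = frechet_derivative f (at p) (axis a 1)"

definition immersion_on :: "(real^3) set \<Rightarrow> (real^3 \<Rightarrow> real^4) \<Rightarrow> bool" where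
  "immersion_on U x \<longleftrightarrow> smooth_on U x \<and> (\<forall>p\<in>U. inj (frechet_derivative x (at p)))"

definition induced_metric :: "(real^3 \<Rightarrow> real^4) \<Rightarrow> real^3 \<Rightarrow> real^3^3" where
  "induced_metric x p = (\<chi> a b. lprod (pd a x p) (pd b x p))"

text \<open>
  The operator \<open>S = -dN\<close>. Writing \<open>-pd b N = (\<Sum>c. S$c$b *\<^sub>R pd c x)\<close> and taking products with
  \<open>pd a x\<close> gives \<open>G ** S = (\<chi> a b. - lprod (pd a x) (pd b N))\<close> for the induced metric \<open>G\<close>.
\<close>

definition shape_op :: "(real^3 \<Rightarrow> real^4) \<Rightarrow> (real^3 \<Rightarrow> real^4) \<Rightarrow> real^3 \<Rightarrow> real^3^3" where
  "shape_op x N p =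
     matrix_inv (induced_metric x p) ** (\<chi> a b. - lprod (pd a x p) (pd b N p))"

text \<open>
  The first Newton transformation \<open>P\<^sub>1 = a\<^sub>1 I + S\<close>, where \<open>a\<^sub>1 = - trace S\<close> is minus the sum of
  the principal curvatures.
\<close>

definition newton1 :: "(real^3 \<Rightarrow> real^4) \<Rightarrow> (real^3 \<Rightarrow> real^4) \<Rightarrow> real^3 \<Rightarrow> real^3^3" where
  "newton1 x N p = mat (- trace (shape_op x N p)) + shape_op x N p"

text \<open>Christoffel symbols of the Levi-Civita connection, with upper index \<open>c\<close>.\<close>

definition christoffel :: "(real^3 \<Rightarrow> real^4) \<Rightarrow> 3 \<Rightarrow> 3 \<Rightarrow> 3 \<Rightarrow> real^3 \<Rightarrow> real" where
  "christoffel x c a b p =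
     (1/2) * (\<Sum>d\<in>UNIV. matrix_inv (induced_metric x p) $ c $ d *
        (pd a (\<lambda>q. induced_metric x q $ b $ d) p
       + pd b (\<lambda>q. induced_metric x q $ a $ d) p
       - pd d (\<lambda>q. induced_metric x q $ a $ b) p))"

definition hessian :: "(real^3 \<Rightarrow> real^4) \<Rightarrow> (real^3 \<Rightarrow> real) \<Rightarrow> real^3 \<Rightarrow> real^3^3" where
  "hessian x f p =
     (\<chi> a b. pd a (pd b f) p - (\<Sum>c\<in>UNIV. christoffel x c a b p * pd c f p))"

text \<open>
  The Cheng--Yau operator \<open>L\<^sub>1 f = trace (P\<^sub>1 \<circ> \<nabla>\<^sup>2 f)\<close>, where \<open>\<nabla>\<^sup>2 f\<close> is the self-adjoint operator
  metrically equivalent to the Hessian of \<open>f\<close>; it acts on vector-valued maps componentwise.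
\<close>

definition L1_real ::
  "(real^3 \<Rightarrow> real^4) \<Rightarrow> (real^3 \<Rightarrow> real^4) \<Rightarrow> (real^3 \<Rightarrow> real) \<Rightarrow> real^3 \<Rightarrow> real" where
  "L1_real x N f p =
     trace (newton1 x N p ** (matrix_inv (induced_metric x p) ** hessian x f p))"

definition L1 ::
  "(real^3 \<Rightarrow> real^4) \<Rightarrow> (real^3 \<Rightarrow> real^4) \<Rightarrow> (real^3 \<Rightarrow> real^4) \<Rightarrow> real^3 \<Rightarrow> real^4" where
  "L1 x N f p = (\<chi> i. L1_real x N (\<lambda>q. f q $ i) p)"

definition second_kind_L1_pointwise_1_type_Gauss_map ::
  "(real^3) set \<Rightarrow> (real^3 \<Rightarrow> real^4) \<Rightarrow> (real^3 \<Rightarrow> real^4) \<Rightarrow> bool" where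
  "second_kind_L1_pointwise_1_type_Gauss_map U x N \<longleftrightarrow>
     (\<exists>(m :: real^3 \<Rightarrow> real) (C :: real^4).
        smooth_on U m \<and> (\<exists>p\<in>U. m p \<noteq> 0) \<and> C \<noteq> 0 \<and>
        (\<forall>p\<in>U. L1 x N N p = m p *\<^sub>R (N p + C)))"


section \<open>Frenet frames and tubular hypersurfaces\<close>

text \<open>\<open>F i\<close> and \<open>k i\<close> are relevant for \<open>i \<in> {1..4}\<close> and \<open>i \<in> {1..3}\<close> only.\<close>

definition frenet_equations ::
  "nat \<Rightarrow> real set \<Rightarrow> (nat \<Rightarrow> real \<Rightarrow> real^4) \<Rightarrow> (nat \<Rightarrow> real \<Rightarrow> real) \<Rightarrow> bool" where
  "frenet_equations j I F k \<longleftrightarrow> (\<forall>s\<in>I.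
     (j = 2 \<longrightarrow>
        (F 1 has_vector_derivative k 1 s *\<^sub>R F 2 s) (at s) \<and>
        (F 2 has_vector_derivative k 1 s *\<^sub>R F 1 s + k 2 s *\<^sub>R F 3 s) (at s) \<and>
        (F 3 has_vector_derivative k 2 s *\<^sub>R F 2 s + k 3 s *\<^sub>R F 4 s) (at s) \<and>
        (F 4 has_vector_derivative - k 3 s *\<^sub>R F 3 s) (at s)) \<and>
     (j = 3 \<longrightarrow>
        (F 1 has_vector_derivative k 1 s *\<^sub>R F 2 s) (at s) \<and>
        (F 2 has_vector_derivative - k 1 s *\<^sub>R F 1 s + k 2 s *\<^sub>R F 3 s) (at s) \<and>
        (F 3 has_vector_derivative k 2 s *\<^sub>R F 2 s + k 3 s *\<^sub>R F 4 s) (at s) \<and>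
        (F 4 has_vector_derivative k 3 s *\<^sub>R F 3 s) (at s)) \<and>
     (j = 4 \<longrightarrow>
        (F 1 has_vector_derivative k 1 s *\<^sub>R F 2 s) (at s) \<and>
        (F 2 has_vector_derivative - k 1 s *\<^sub>R F 1 s + k 2 s *\<^sub>R F 3 s) (at s) \<and>
        (F 3 has_vector_derivative - k 2 s *\<^sub>R F 2 s + k 3 s *\<^sub>R F 4 s) (at s) \<and>
        (F 4 has_vector_derivative k 3 s *\<^sub>R F 3 s) (at s)))"

definition frenet_curve ::
  "nat \<Rightarrow> real set \<Rightarrow> (real \<Rightarrow> real^4) \<Rightarrow> (nat \<Rightarrow> real \<Rightarrow> real^4) \<Rightarrow> (nat \<Rightarrow> real \<Rightarrow> real) \<Rightarrow> bool" where
  "frenet_curve j I \<beta> F k \<longleftrightarrow>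
     smooth_on I \<beta> \<and> (\<forall>i\<in>{1..4}. smooth_on I (F i)) \<and> (\<forall>i\<in>{1..3}. smooth_on I (k i)) \<and>
     (\<forall>s\<in>I. (\<beta> has_vector_derivative F 1 s) (at s)) \<and>
     (\<forall>s\<in>I. \<forall>i\<in>{1..4}. \<forall>l\<in>{1..4}.
        lprod (F i s) (F l s) = (if i \<noteq> l then 0 else if i = j then -1 else 1)) \<and>
     frenet_equations j I F k"

text \<open>
  The indices \<open>j, j+1, j+2\<close> are read cyclically in \<open>{2,3,4}\<close>: 5 stands for 2 and 6 for 3.
  For \<open>\<lambda> = 1\<close> or \<open>\<lambda> = -1\<close> the exponents are 0 or 1, and a zeroth power is 1 also for base 0.
\<close>

definition mu :: "nat \<Rightarrow> int \<Rightarrow> nat \<Rightarrow> real \<Rightarrow> real \<Rightarrow> real" where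
  "mu j l i t w =
     (if i = j then
        sinh w powi ((1 + l) div 2) * cosh w powi ((1 - l) div 2) * cosh t
      else if i = j + 1 \<or> i + 3 = j + 1 then
        sinh w powi ((1 - l) div 2) * cosh w powi ((1 + l) div 2)
      else if i = j + 2 \<or> i + 3 = j + 2 then
        sinh w powi ((1 + l) div 2) * cosh w powi ((1 - l) div 2) * sinh t
      else 0)"

text \<open>The coordinates of \<open>p :: real^3\<close> are \<open>(s, t, w)\<close>.\<close>

definition tubular ::
  "nat \<Rightarrow> int \<Rightarrow> real \<Rightarrow> (real \<Rightarrow> real^4) \<Rightarrow> (nat \<Rightarrow> real \<Rightarrow> real^4) \<Rightarrow> real^3 \<Rightarrow> real^4" where
  "tubular j l r \<beta> F p =
     \<beta> (p $ 1) + r *\<^sub>R (\<Sum>i=2..4. mu j l i (p $ 2) (p $ 3) *\<^sub>R F i (p $ 1))"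

definition tubular_gauss ::
  "nat \<Rightarrow> int \<Rightarrow> (nat \<Rightarrow> real \<Rightarrow> real^4) \<Rightarrow> real^3 \<Rightarrow> real^4" where
  "tubular_gauss j l F p =
     (- ((-1) ^ fact (4 - j)) * of_int l ^ j) *\<^sub>R
       (\<Sum>i=2..4. mu j l i (p $ 2) (p $ 3) *\<^sub>R F i (p $ 1))"

end

theory Submission
  imports Defs
begin

text \<open>
  Since \<open>N = -\<kappa> (x - \<beta>(s))\<close> with \<open>\<kappa>\<close> constant, the Hessian of \<open>N\<close> is a multiple of \<open>N\<close> (by the
  Gauss formula for \<open>x\<close>) plus a contribution of \<open>\<beta>\<close>, a function of the single coordinate \<open>s\<close>.
  Contracting with \<open>P\<^sub>1\<close> gives
  \<open>L\<^sub>1 N = D N - (2 \<kappa>\<^sup>2 k\<^sub>1 / A\<^sup>2) F\<^sub>2 + c F\<^sub>1\<close> with \<open>D = \<epsilon> \<kappa>\<^sup>3 (6 - 4 / A)\<close> and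
  \<open>A = 1 + k\<^sub>1 \<langle>N, F\<^sub>2\<rangle> / \<kappa>\<close>, where \<open>c = 0\<close> if \<open>k\<^sub>1\<close> vanishes identically.
  Suppose this equals \<open>m (N + C)\<close> and fix \<open>s\<close>, so that the \<open>\<langle>C, F\<^sub>i\<rangle>\<close> are constants.  The \<open>F\<^sub>3\<close> and
  \<open>F\<^sub>4\<close> components and the affine independence of the \<open>\<mu>\<^sub>i\<close> force \<open>\<langle>C, F\<^sub>3\<rangle> = \<langle>C, F\<^sub>4\<rangle> = 0\<close> and
  \<open>m = D\<close>; the \<open>F\<^sub>2\<close> component is then a quadratic equation with constant coefficients for the
  nonconstant function \<open>\<langle>N, F\<^sub>2\<rangle>\<close>, which forces \<open>k\<^sub>1 = 0\<close> and \<open>\<langle>C, F\<^sub>2\<rangle> = 0\<close>.  Hence \<open>k\<^sub>1\<close> vanishes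
  identically, \<open>c = 0\<close>, and the \<open>F\<^sub>1\<close> component gives \<open>C = 0\<close>.
\<close>

section \<open>Symmetry of second derivatives\<close>


text \<open>The mean value theorem along \<open>u\<close>, applied to the increment of
  \<open>f\<close> across \<open>h *\<^sub>R v\<close>, turns the second difference into
  \<open>h\<close> times an increment of \<open>f' q u\<close>; differentiability of that map at
  \<open>p\<close> evaluates it.\<close>

lemma second_difference_estimate:
  fixes f :: "'a::real_normed_vector \<Rightarrow> real"
  assumes "open U" "p \<in> U" and f: "\<And>q. q \<in> U \<Longrightarrow> (f has_derivative f' q) (at q)"
    and A: "((\<lambda>q. f' q u) has_derivative A) (at p)" and "e > 0"
  shows "\<exists>d>0. \<forall>h. 0 < h \<and> h < d \<longrightarrow>
    \<bar>f (p + h *\<^sub>R u + h *\<^sub>R v) - f (p + h *\<^sub>R u) - f (p + h *\<^sub>R v) + f p - h\<^sup>2 * A v\<bar> \<le> e * h\<^sup>2"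
proof -
  \<comment> \<open>\<open>h * M\<close> bounds the norm of every combination of \<open>u\<close>
    and \<open>v\<close> with coefficients in [0, h]; the summand 1 keeps \<open>M\<close> positive
    when both vectors vanish.\<close>
  define M where "M = norm u + norm v + 1"
  have M: "M > 0" unfolding M_def by (smt (verit) norm_ge_zero)
  obtain d1 where d1: "d1 > 0" "\<And>y. norm (y - p) < d1 \<Longrightarrow> y \<in> U"
    using \<open>open U\<close> \<open>p \<in> U\<close> unfolding open_dist dist_norm by blast
  \<comment> \<open>Two approximation errors are added later, hence the 2; \<open>M\<close> cancels
    against the bound \<open>h * M\<close>.\<close>
  have "e / (2 * M) > 0" using M \<open>e > 0\<close> by simp
  then obtain d2 where d2: "d2 > 0"
    "\<And>y. norm (y - p) < d2 \<Longrightarrow> \<bar>f' y u - f' p u - A (y - p)\<bar> \<le> e / (2 * M) * norm (y - p)"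
    using A unfolding has_derivative_at_alt real_norm_def by metis
  interpret A: bounded_linear A using A by (rule has_derivative_bounded_linear)
  show ?thesis
  proof (intro exI conjI allI impI)
    show "min d1 d2 / M > 0" using d1(1) d2(1) M by simp
    fix h assume h: "0 < h \<and> h < min d1 d2 / M"
    hence hM: "h * M < d1" "h * M < d2" using M by (auto simp: field_simps)
    have near: "norm (\<theta> *\<^sub>R u + \<eta> *\<^sub>R v) \<le> h * M" if "0 \<le> \<theta>" "\<theta> \<le> h" "0 \<le> \<eta>" "\<eta> \<le> h" for \<theta> \<eta>
    proof -
      have "norm (\<theta> *\<^sub>R u + \<eta> *\<^sub>R v) \<le> \<theta> * norm u + \<eta> * norm v"
        using that norm_triangle_ineq[of "\<theta> *\<^sub>R u" "\<eta> *\<^sub>R v"] by simp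
      also have "\<dots> \<le> h * norm u + h * norm v" using that by (intro add_mono mult_right_mono) auto
      also have "\<dots> \<le> h * M" using h by (simp add: M_def algebra_simps)
      finally show ?thesis .
    qed
    have inU: "p + \<theta> *\<^sub>R u + \<eta> *\<^sub>R v \<in> U" if "0 \<le> \<theta>" "\<theta> \<le> h" "0 \<le> \<eta>" "\<eta> \<le> h" for \<theta> \<eta>
      using near[OF that] hM d1(2)[of "p + \<theta> *\<^sub>R u + \<eta> *\<^sub>R v"] by (simp add: add.assoc)
    \<comment> \<open>\<open>\<phi> h - \<phi> 0\<close> is the second difference. The term
      \<open>0 *\<^sub>R v\<close> is kept so that \<open>f1\<close> and \<open>est\<close> apply
      with \<open>\<eta> = 0\<close>.\<close>
    define \<phi> where "\<phi> \<theta> = f (p + \<theta> *\<^sub>R u + h *\<^sub>R v) - f (p + \<theta> *\<^sub>R u + 0 *\<^sub>R v)" for \<theta>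
    have f1: "((\<lambda>\<theta>. f (p + \<theta> *\<^sub>R u + \<eta> *\<^sub>R v)) has_real_derivative f' (p + \<theta> *\<^sub>R u + \<eta> *\<^sub>R v) u) (at \<theta>)"
      if "0 \<le> \<theta>" "\<theta> \<le> h" "0 \<le> \<eta>" "\<eta> \<le> h" for \<theta> \<eta>
    proof -
      have "((\<lambda>\<theta>. p + \<theta> *\<^sub>R u + \<eta> *\<^sub>R v) has_derivative (\<lambda>t. t *\<^sub>R u)) (at \<theta>)"
        by (auto intro!: derivative_eq_intros)
      from has_derivative_compose[OF this f[OF inU[OF that]]]
      have "((\<lambda>\<theta>. f (p + \<theta> *\<^sub>R u + \<eta> *\<^sub>R v)) has_derivative (\<lambda>t. f' (p + \<theta> *\<^sub>R u + \<eta> *\<^sub>R v) (t *\<^sub>R u))) (at \<theta>)" .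
      moreover have "f' (p + \<theta> *\<^sub>R u + \<eta> *\<^sub>R v) (t *\<^sub>R u) = f' (p + \<theta> *\<^sub>R u + \<eta> *\<^sub>R v) u * t" for t
        using linear_scale[OF has_derivative_linear[OF f[OF inU[OF that]]]] by simp
      ultimately show ?thesis unfolding has_field_derivative_def by simp
    qed
    have "\<exists>z. 0 < z \<and> z < h \<and> \<phi> h - \<phi> 0 =
        (h - 0) * (f' (p + z *\<^sub>R u + h *\<^sub>R v) u - f' (p + z *\<^sub>R u + 0 *\<^sub>R v) u)"
      unfolding \<phi>_def using h by (intro MVT2 DERIV_diff f1) auto
    then obtain z where z: "0 < z" "z < h"
      "\<phi> h - \<phi> 0 = h * (f' (p + z *\<^sub>R u + h *\<^sub>R v) u - f' (p + z *\<^sub>R u + 0 *\<^sub>R v) u)" by auto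
    have est: "\<bar>f' (p + z *\<^sub>R u + \<eta> *\<^sub>R v) u - f' p u - A (z *\<^sub>R u + \<eta> *\<^sub>R v)\<bar> \<le> e / 2 * h"
      if "0 \<le> \<eta>" "\<eta> \<le> h" for \<eta>
    proof -
      have n: "norm (z *\<^sub>R u + \<eta> *\<^sub>R v) \<le> h * M" using near z that by simp
      have "e / (2 * M) * norm (z *\<^sub>R u + \<eta> *\<^sub>R v) \<le> e / (2 * M) * (h * M)"
        using n M \<open>e > 0\<close> by (intro mult_left_mono) auto
      also have "\<dots> = e / 2 * h" using M by simp
      finally have b: "e / (2 * M) * norm (z *\<^sub>R u + \<eta> *\<^sub>R v) \<le> e / 2 * h" .
      have "norm (p + (z *\<^sub>R u + \<eta> *\<^sub>R v) - p) < d2" using n hM by simp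
      from order_trans[OF d2(2)[OF this]] b show ?thesis by (simp only: add.assoc add_diff_cancel_left')
    qed
    have "A (z *\<^sub>R u + h *\<^sub>R v) - A (z *\<^sub>R u + 0 *\<^sub>R v) = h * A v"
      by (simp add: A.add A.scaleR)
    with est[of h] est[of 0] h
    have "\<bar>f' (p + z *\<^sub>R u + h *\<^sub>R v) u - f' (p + z *\<^sub>R u + 0 *\<^sub>R v) u - h * A v\<bar> \<le> e * h" by linarith
    hence "h * \<bar>f' (p + z *\<^sub>R u + h *\<^sub>R v) u - f' (p + z *\<^sub>R u + 0 *\<^sub>R v) u - h * A v\<bar> \<le> h * (e * h)"
      using h by (intro mult_left_mono) auto
    moreover have "h * \<bar>f' (p + z *\<^sub>R u + h *\<^sub>R v) u - f' (p + z *\<^sub>R u + 0 *\<^sub>R v) u - h * A v\<bar>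
        = \<bar>\<phi> h - \<phi> 0 - h\<^sup>2 * A v\<bar>"
    proof -
      have "h * (f' (p + z *\<^sub>R u + h *\<^sub>R v) u - f' (p + z *\<^sub>R u + 0 *\<^sub>R v) u - h * A v) = \<phi> h - \<phi> 0 - h\<^sup>2 * A v"
        unfolding z(3) by (simp add: power2_eq_square algebra_simps)
      moreover have "h * \<bar>y\<bar> = \<bar>h * y\<bar>" for y using h by (simp add: abs_mult)
      ultimately show ?thesis by simp
    qed
    ultimately show "\<bar>f (p + h *\<^sub>R u + h *\<^sub>R v) - f (p + h *\<^sub>R u) - f (p + h *\<^sub>R v) + f p - h\<^sup>2 * A v\<bar> \<le> e * h\<^sup>2"
      by (simp add: \<phi>_def power2_eq_square mult_ac)
  qed
qed

text \<open>The second difference is symmetric in \<open>u\<close> and \<open>v\<close>, and divided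
  by \<open>h\<^sup>2\<close> it tends to both \<open>A v\<close> and \<open>B u\<close>.\<close>

lemma second_derivative_symmetric:
  fixes f :: "'a::real_normed_vector \<Rightarrow> real"
  assumes "open U" "p \<in> U" and f: "\<And>q. q \<in> U \<Longrightarrow> (f has_derivative f' q) (at q)"
    and A: "((\<lambda>q. f' q u) has_derivative A) (at p)"
    and B: "((\<lambda>q. f' q v) has_derivative B) (at p)"
  shows "A v = B u"
proof (rule ccontr)
  assume neq: "A v \<noteq> B u"
  \<comment> \<open>With a third of the gap, the two estimates together allow only 2/3 of
    it.\<close>
  define e where "e = \<bar>A v - B u\<bar> / 3"
  have e: "e > 0" using neq by (simp add: e_def)
  obtain d1 where d1: "d1 > 0" "\<And>h. 0 < h \<and> h < d1 \<Longrightarrow>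
      \<bar>f (p + h *\<^sub>R u + h *\<^sub>R v) - f (p + h *\<^sub>R u) - f (p + h *\<^sub>R v) + f p - h\<^sup>2 * A v\<bar> \<le> e * h\<^sup>2"
    using second_difference_estimate[OF assms(1,2) f A e, where v = v] by blast
  obtain d2 where d2: "d2 > 0" "\<And>h. 0 < h \<and> h < d2 \<Longrightarrow>
      \<bar>f (p + h *\<^sub>R v + h *\<^sub>R u) - f (p + h *\<^sub>R v) - f (p + h *\<^sub>R u) + f p - h\<^sup>2 * B u\<bar> \<le> e * h\<^sup>2"
    using second_difference_estimate[OF assms(1,2) f B e, where v = u] by blast
  define h where "h = min d1 d2 / 2"
  have h: "0 < h" "h < d1" "h < d2" using d1(1) d2(1) by (auto simp: h_def)
  have "p + h *\<^sub>R v + h *\<^sub>R u = p + h *\<^sub>R u + h *\<^sub>R v" by simp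
  with d1(2)[of h] d2(2)[of h] h have "\<bar>h\<^sup>2 * A v - h\<^sup>2 * B u\<bar> \<le> 2 * (e * h\<^sup>2)"
    by simp
  moreover have "\<bar>h\<^sup>2 * A v - h\<^sup>2 * B u\<bar> = 3 * (e * h\<^sup>2)"
    by (simp add: e_def abs_mult flip: right_diff_distrib)
  ultimately have "e * h\<^sup>2 \<le> 0" by linarith
  thus False using e h by (simp add: mult_le_0_iff)
qed

section \<open>The functions mu\<close>

text \<open>Two differentiations on the open set leave a linear system for \<open>b\<close> and
  \<open>c\<close> whose determinant is, up to sign, cosh^2 - sinh^2 = 1.\<close>

lemma sinh_cosh_affine_independent:
  fixes a b c :: real
  assumes "open J" "x \<in> J" and z: "\<And>t. t \<in> J \<Longrightarrow> a + b * cosh t + c * sinh t = 0"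
  shows "a = 0" "b = 0" "c = 0"
proof -
  have d: "g' = 0" if "(g has_real_derivative g') (at t)" "t \<in> J" "\<And>t. t \<in> J \<Longrightarrow> g t = 0" for g g' and t :: real
  proof -
    have "((\<lambda>_. 0) has_real_derivative g') (at t)"
      using that \<open>open J\<close> by (intro DERIV_cong_ev[THEN iffD1, OF refl _ refl that(1)])
        (auto intro!: eventually_nhds_in_open elim: eventually_mono[rotated] simp: eventually_nhds)
    thus ?thesis by (rule DERIV_unique) simp
  qed
  have z1: "b * sinh t + c * cosh t = 0" if "t \<in> J" for t
    by (rule d[OF _ that z]) (auto intro!: derivative_eq_intros)
  have z2: "b * cosh x + c * sinh x = 0"
    by (rule d[OF _ \<open>x \<in> J\<close> z1]) (auto intro!: derivative_eq_intros)
  have "b * ((cosh x)\<^sup>2 - (sinh x)\<^sup>2) = cosh x * (b * cosh x + c * sinh x) - sinh x * (b * sinh x + c * cosh x)"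
    "c * ((cosh x)\<^sup>2 - (sinh x)\<^sup>2) = cosh x * (b * sinh x + c * cosh x) - sinh x * (b * cosh x + c * sinh x)"
    by (simp_all add: algebra_simps power2_eq_square)
  thus "b = 0" "c = 0" using z1[OF \<open>x \<in> J\<close>] z2 by (simp_all add: cosh_square_eq)
  thus "a = 0" using z[OF \<open>x \<in> J\<close>] by simp
qed

text \<open>Up to order the functions are \<open>S w * cosh t\<close>, \<open>C w\<close>,
  \<open>S w * sinh t\<close> with \<open>S\<close>, \<open>C\<close> being sinh and cosh. Freezing
  \<open>w\<close> where \<open>S\<close> is nonzero kills the outer two coefficients by
  independence in \<open>t\<close>; varying \<open>w\<close> then kills the rest.\<close>

lemma mu_affine_independent:
  assumes j: "j \<in> {2, 3, 4}" and l: "l \<in> {1, - 1}" and "open V" "open W" "V \<noteq> {}" "W \<noteq> {}"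
    and z: "\<And>t w. t \<in> V \<Longrightarrow> w \<in> W \<Longrightarrow> a + b * mu j l 2 t w + c * mu j l 3 t w + d * mu j l 4 t w = 0"
  shows "a = 0 \<and> b = 0 \<and> c = 0 \<and> d = 0"
proof -
  obtain t0 w0 where t0: "t0 \<in> V" and w0: "w0 \<in> W" using assms by blast
  \<comment> \<open>At \<open>w1\<close> both sinh and cosh are nonzero, so the same point serves
    for either choice of \<open>S\<close>.\<close>
  obtain w1 where w1: "w1 \<in> W" "sinh w1 \<noteq> 0"
    using sinh_cosh_affine_independent(3)[OF \<open>open W\<close> w0, of 0 0 1] by auto
  have c1: "cosh w1 \<noteq> 0" using cosh_real_pos[of w1] by simp
  have *: "a' = 0 \<and> b' = 0 \<and> c' = 0 \<and> d' = 0"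
    if sc: "(S, C) = (sinh, cosh) \<or> (S, C) = (cosh, sinh)"
      and z': "\<And>t w. t \<in> V \<Longrightarrow> w \<in> W \<Longrightarrow> a' + b' * (S w * cosh t) + c' * C w + d' * (S w * sinh t) = 0"
    for S C :: "real \<Rightarrow> real" and a' b' c' d' :: real
  proof -
    have "S w1 \<noteq> 0" using sc w1 c1 by auto
    moreover have "S w1 * b' = 0" "S w1 * d' = 0"
      using sinh_cosh_affine_independent(2,3)[OF \<open>open V\<close> t0, of "a' + c' * C w1" "S w1 * b'" "S w1 * d'"]
        z'[OF _ w1(1)] by (auto simp: algebra_simps)
    ultimately have bd: "b' = 0" "d' = 0" by auto
    have "a' + c' * C w = 0" if "w \<in> W" for w using z'[OF t0 that] bd by simp
    with sc have "a' = 0 \<and> c' = 0"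
      using sinh_cosh_affine_independent(1,2)[OF \<open>open W\<close> w0, of a' c' 0]
        sinh_cosh_affine_independent(1,3)[OF \<open>open W\<close> w0, of a' 0 c'] by auto
    with bd show ?thesis by simp
  qed
  note s = *[of sinh cosh, simplified] and c = *[of cosh sinh, simplified]
  \<comment> \<open>The order in which \<open>b\<close>, \<open>c\<close>, \<open>d\<close> are
    passed below follows the cyclic positions \<open>j\<close>, \<open>j + 1\<close>,
    \<open>j + 2\<close>.\<close>
  from j l consider "j = 2" "l = 1" | "j = 2" "l = -1" | "j = 3" "l = 1" | "j = 3" "l = -1"
    | "j = 4" "l = 1" | "j = 4" "l = -1" by auto
  then show ?thesis
    using z
    apply cases
    subgoal using s[of a b c d] by (simp add: mu_def)
    subgoal using c[of a b c d] by (simp add: mu_def)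
    subgoal using s[of a c d b] by (simp add: mu_def algebra_simps)
    subgoal using c[of a c d b] by (simp add: mu_def algebra_simps)
    subgoal using s[of a d b c] by (simp add: mu_def algebra_simps)
    subgoal using c[of a d b c] by (simp add: mu_def algebra_simps)
    done
qed


text \<open>This is what gives the Gauss map its constant square: cosh^2 - sinh^2 = 1 eliminates
  first \<open>t\<close>, then \<open>w\<close>.\<close>

lemma mu_quadric:
  assumes "j \<in> {2, 3, 4}" "l \<in> {1, - 1}"
  defines "e \<equiv> \<lambda>i. if i = j then -1 else (1::real)"
  shows "e 2 * (mu j l 2 t w)\<^sup>2 + e 3 * (mu j l 3 t w)\<^sup>2 + e 4 * (mu j l 4 t w)\<^sup>2 = of_int l"
proof -
  have "(S * cosh t)\<^sup>2 = S\<^sup>2 + (S * sinh t)\<^sup>2" for S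
    by (simp add: power_mult_distrib cosh_square_eq algebra_simps)
  with assms show ?thesis
    by (auto simp: mu_def cosh_square_eq)
qed

lemma continuous_on_mu:
  assumes "l \<in> {1, - 1}"
  shows "continuous_on X (\<lambda>z. mu j l i (fst z) (snd z))"
  by (cases "i = j"; cases "i = j + 1 \<or> i + 3 = j + 1"; cases "i = j + 2 \<or> i + 3 = j + 2")
    (use assms in \<open>auto simp: mu_def intro!: continuous_intros\<close>)

section \<open>The Lorentzian product and coordinate derivatives\<close>

lemma lprod_bounded_bilinear: "bounded_bilinear lprod"
  unfolding bilinear_conv_bounded_bilinear[symmetric] bilinear_def
  by (intro conjI allI linearI) (simp_all add: lprod_def algebra_simps)

interpretation lprod: bounded_bilinear lprod by (rule lprod_bounded_bilinear)

lemma lprod_commute: "lprod x y = lprod y x"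
  by (simp add: lprod_def mult.commute)

lemma lprod_nondegenerate:
  assumes "\<And>y. lprod x y = 0"
  shows "x = 0"
  using assms[of "axis 1 1"] assms[of "axis 2 1"] assms[of "axis 3 1"] assms[of "axis 4 1"]
  by (simp add: lprod_def axis_def vec_eq_iff forall_4)

text \<open>The linear map \<open>T\<close> with these vectors as columns is injective, hence
  surjective, so \<open>y\<close> is orthogonal to the whole space.\<close>

lemma orthogonal_to_independent:
  fixes z1 z2 z3 z4 :: "real^4"
  assumes indep: "\<And>a b c d. a *\<^sub>R z1 + b *\<^sub>R z2 + c *\<^sub>R z3 + d *\<^sub>R z4 = 0 \<Longrightarrow> a = 0 \<and> b = 0 \<and> c = 0 \<and> d = 0"
    and "lprod y z1 = 0" "lprod y z2 = 0" "lprod y z3 = 0" "lprod y z4 = 0"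
  shows "y = 0"
proof (rule lprod_nondegenerate)
  fix v
  define T where "T x = x$1 *\<^sub>R z1 + x$2 *\<^sub>R z2 + x$3 *\<^sub>R z3 + x$4 *\<^sub>R z4" for x :: "real^4"
  have lin: "linear T"
    unfolding T_def by (intro linearI) (simp_all add: algebra_simps)
  have "inj T"
    unfolding linear_injective_0[OF lin]
  proof (intro allI impI)
    fix x assume "T x = 0"
    from indep[OF this[unfolded T_def]] show "x = 0" by (simp add: vec_eq_iff forall_4)
  qed
  hence "surj T" using lin by (simp add: linear_injective_imp_surjective)
  then obtain x where "v = T x" by blast
  thus "lprod y v = 0" using assms(2-) by (simp add: T_def lprod.add_right lprod.scaleR_right)
qed

section \<open>Rules for coordinate derivatives and smoothness\<close>

lemma pd_eqI: "(f has_derivative f') (at p) \<Longrightarrow> pd a f p = f' (axis a 1)"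
  unfolding pd_def using frechet_derivative_at by metis

text \<open>\<open>frechet_derivative\<close> chooses among the derivatives of a function at
  \<open>p\<close>; functions agreeing near \<open>p\<close> have the same ones, so the choices
  coincide.\<close>

lemma pd_cong:
  assumes "open U" "p \<in> U" "\<And>q. q \<in> U \<Longrightarrow> f q = g q"
  shows "pd a f p = pd a g p"
proof -
  have "(f has_derivative D) (at p) \<longleftrightarrow> (g has_derivative D) (at p)" for D
    using has_derivative_transform_within_open[OF _ assms(1,2)] assms(3) by metis
  thus ?thesis by (simp add: pd_def frechet_derivative_def)
qed

lemma differentiable_has_pd:
  "f differentiable (at p) \<Longrightarrow> (f has_derivative frechet_derivative f (at p)) (at p)"
  by (simp add: frechet_derivative_works)

lemma pd_const [simp]: "pd a (\<lambda>q. c) p = 0"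
  by (simp add: pd_def)

lemma pd_lprod:
  assumes "f differentiable (at p)" "g differentiable (at p)"
  shows "pd a (\<lambda>q. lprod (f q) (g q)) p = lprod (pd a f p) (g p) + lprod (f p) (pd a g p)"
  using pd_eqI[OF lprod.FDERIV[OF assms[THEN differentiable_has_pd]], of a]
  by (simp add: pd_def)

lemma pd_component:
  assumes "f differentiable (at p)"
  shows "pd a (\<lambda>q. f q $ i) p = pd a f p $ i"
  using pd_eqI[OF bounded_linear.has_derivative[OF bounded_linear_vec_nth differentiable_has_pd[OF assms]]]
  by (simp add: pd_def)

lemma has_derivative_coord_1:
  fixes g :: "real \<Rightarrow> 'b::real_normed_vector"
  assumes "(g has_vector_derivative g') (at (p $ 1))"
  shows "((\<lambda>q::real^3. g (q $ 1)) has_derivative (\<lambda>v. (v $ 1) *\<^sub>R g')) (at p)"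
proof -
  have "((\<lambda>q::real^3. q $ 1) has_derivative (\<lambda>v. v $ 1)) (at p)"
    by (rule bounded_linear_imp_has_derivative) (rule bounded_linear_vec_nth)
  from has_derivative_compose[OF this assms[unfolded has_vector_derivative_def]] show ?thesis .
qed

lemma frechet_derivative_eq_sum_pd:
  assumes "f differentiable (at p)"
  shows "frechet_derivative f (at p) v = (\<Sum>a\<in>UNIV. v $ a *\<^sub>R pd a f p)"
proof -
  have lin: "linear (frechet_derivative f (at p))" using assms by (rule linear_frechet_derivative)
  have "v = (\<Sum>a\<in>UNIV. v $ a *\<^sub>R axis a 1)"
    using basis_expansion[of v] by (simp add: scalar_mult_eq_scaleR)
  hence "frechet_derivative f (at p) v = frechet_derivative f (at p) (\<Sum>a\<in>UNIV. v $ a *\<^sub>R axis a 1)" by simp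
  also have "\<dots> = (\<Sum>a\<in>UNIV. v $ a *\<^sub>R pd a f p)"
    by (simp add: linear_sum[OF lin] linear_scale[OF lin] pd_def)
  finally show ?thesis .
qed

lemma smooth_on_differentiable: "smooth_on U f \<Longrightarrow> p \<in> U \<Longrightarrow> f differentiable (at p)"
  unfolding smooth_on_def by (drule spec[of _ "Suc 0"]) simp

lemma smooth_on_frechet_derivative:
  assumes "smooth_on U f"
  shows "smooth_on U (\<lambda>q. frechet_derivative f (at q) v)"
  unfolding smooth_on_def
proof
  fix n
  show "Ck_on n U (\<lambda>q. frechet_derivative f (at q) v)"
    using assms[unfolded smooth_on_def, rule_format, of "Suc n"] by simp
qed

lemma smooth_on_pd: "smooth_on U f \<Longrightarrow> smooth_on U (pd a f)"
  unfolding pd_def[abs_def] by (rule smooth_on_frechet_derivative)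

lemma pd_commute:
  fixes f :: "real^3 \<Rightarrow> real^'n"
  assumes "open U" "p \<in> U" "smooth_on U f"
  shows "pd a (pd b f) p = pd b (pd a f) p"
proof -
  have "pd a (pd b f) p $ i = pd b (pd a f) p $ i" for i
  proof -
    have d1: "((\<lambda>q. f q $ i) has_derivative (\<lambda>v. frechet_derivative f (at q) v $ i)) (at q)" if "q \<in> U" for q
      by (intro bounded_linear.has_derivative[OF bounded_linear_vec_nth]
          differentiable_has_pd smooth_on_differentiable[OF assms(3) that])
    have "((\<lambda>q. pd c f q $ i) has_derivative (\<lambda>v. frechet_derivative (pd c f) (at p) v $ i)) (at p)" for c
      by (intro bounded_linear.has_derivative[OF bounded_linear_vec_nth]
          differentiable_has_pd smooth_on_differentiable[OF smooth_on_pd[OF assms(3)] assms(2)])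
    note d = this
    show ?thesis
      unfolding pd_def[of a "pd b f"] pd_def[of b "pd a f"]
      by (rule second_derivative_symmetric[OF assms(1,2), where f = "\<lambda>q. f q $ i" and
          f' = "\<lambda>q v. frechet_derivative f (at q) v $ i"])
        (use d1 d[of a] d[of b] in \<open>simp_all add: pd_def[abs_def]\<close>)
  qed
  thus ?thesis by (simp add: vec_eq_iff)
qed


section \<open>The Gauss map of a canal hypersurface\<close>

text \<open>\<open>matrix_inv\<close> is a choice of a two-sided inverse, meaningful once a trivial
  kernel guarantees existence.\<close>

lemma matrix_inv_works:
  fixes M :: "real^'n^'n"
  assumes "\<And>v. M *v v = 0 \<Longrightarrow> v = 0"
  shows "matrix_inv M ** M = mat 1" "M ** matrix_inv M = mat 1"
proof -
  have "invertible M"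
    unfolding invertible_left_inverse matrix_left_invertible_ker using assms by blast
  hence "\<exists>B. M ** B = mat 1 \<and> B ** M = mat 1" by (simp add: invertible_def)
  from someI_ex[OF this] show "matrix_inv M ** M = mat 1" "M ** matrix_inv M = mat 1"
    by (simp_all add: matrix_inv_def)
qed

lemma trace_mul_mul_linear:
  fixes P M A B C :: "real^'n^'n"
  shows "trace (P ** (M ** (a *\<^sub>R A + b *\<^sub>R B + c *\<^sub>R C))) =
    a * trace (P ** (M ** A)) + b * trace (P ** (M ** B)) + c * trace (P ** (M ** C))"
  by (simp add: trace_def matrix_matrix_mult_def sum.distrib sum_distrib_left algebra_simps)

text \<open>Here \<open>S\<close> is the shape operator, and \<open>J\<close> is the inverse metric times the matrix unit \<open>E\<^sub>1\<^sub>1\<close>.\<close>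

lemma newton_traces:
  fixes g :: "real^3" and A \<kappa> :: real
  assumes "g $ 1 = 1 / A\<^sup>2" "A \<noteq> 0"
  defines "S \<equiv> \<chi> a b. \<kappa> * ((if a = b then 1 else 0) - (if b = 1 then A * g $ a else 0))"
    and "J \<equiv> \<chi> a b. if b = 1 then g $ a else 0"
  shows "trace ((mat (- trace S) + S) ** S) = \<kappa>\<^sup>2 * (4 / A - 6)"
    and "trace ((mat (- trace S) + S) ** J) = - 2 * \<kappa> / A\<^sup>2"
proof -
  \<comment> \<open>\<open>S\<close> is a rank-one perturbation of \<kappa> times the identity, with
    eigenvalues \<kappa>, \<kappa> and \<open>\<kappa> * (1 - 1 / A)\<close>.\<close>
  have 1: "trace S = \<kappa> * (3 - 1 / A)"
    using assms(2) by (simp add: S_def trace_def sum_3 assms(1)) (simp add: field_simps power2_eq_square)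
  show "trace ((mat (- trace S) + S) ** S) = \<kappa>\<^sup>2 * (4 / A - 6)"
    unfolding 1 using assms(2)
    by (simp add: S_def trace_def matrix_matrix_mult_def mat_def sum_3 assms(1))
      (simp add: field_simps power2_eq_square)
  show "trace ((mat (- trace S) + S) ** J) = - 2 * \<kappa> / A\<^sup>2"
    unfolding 1 using assms(2)
    by (simp add: S_def J_def trace_def matrix_matrix_mult_def mat_def sum_3 assms(1))
      (simp add: field_simps power2_eq_square)
qed

text \<open>An envelope of spheres centered on \<beta>, with the functions \<open>mu\<close>
  forgotten, so that all \<open>j\<close> and both signs of \<lambda> are treated at once. \<kappa>
  is the signed inverse radius, \<epsilon> the square of the normal, and \<open>K\<close> the
  derivative of \<open>T\<close>.\<close>

locale canal_hypersurface =
  fixes U :: "(real^3) set" and I :: "real set" and x N :: "real^3 \<Rightarrow> real^4"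
    and \<beta> T K :: "real \<Rightarrow> real^4" and \<kappa> \<epsilon> :: real
  assumes open_U: "open U" and proj: "\<And>p. p \<in> U \<Longrightarrow> p $ 1 \<in> I"
    and imm: "immersion_on U x"
    and deriv_\<beta>: "\<And>s. s \<in> I \<Longrightarrow> (\<beta> has_vector_derivative T s) (at s)"
    and deriv_T: "\<And>s. s \<in> I \<Longrightarrow> (T has_vector_derivative K s) (at s)"
    and T_unit: "\<And>s. s \<in> I \<Longrightarrow> lprod (T s) (T s) = 1"
    and \<kappa>_nz: "\<kappa> \<noteq> 0" and \<epsilon>_sq: "\<epsilon> * \<epsilon> = 1"
    and N_eq: "\<And>q. q \<in> U \<Longrightarrow> N q = - \<kappa> *\<^sub>R (x q - \<beta> (q $ 1))"
    and N_N: "\<And>q. q \<in> U \<Longrightarrow> lprod (N q) (N q) = \<epsilon>"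
    and N_T: "\<And>q. q \<in> U \<Longrightarrow> lprod (N q) (T (q $ 1)) = 0"
begin

text \<open>The factor by which \<open>\<partial>x/\<partial>s\<close> stretches \<open>T\<close>, that is, \<open>\<langle>\<partial>x/\<partial>s, T\<rangle>\<close>.\<close>

definition A :: "real^3 \<Rightarrow> real" where
  "A p = 1 + lprod (N p) (K (p $ 1)) / \<kappa>"

section \<open>First and second derivatives of the Gauss map, and their products with the normal and
  \<open>T\<close>\<close>

lemma smooth_x: "smooth_on U x"
  using imm by (simp add: immersion_on_def)

lemma differentiable_x: "p \<in> U \<Longrightarrow> x differentiable (at p)"
  using smooth_x by (rule smooth_on_differentiable)

lemma differentiable_pd_x: "p \<in> U \<Longrightarrow> pd b x differentiable (at p)"
  using smooth_on_pd[OF smooth_x] by (rule smooth_on_differentiable)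

lemma derivative_\<beta>: "p \<in> U \<Longrightarrow> ((\<lambda>q::real^3. \<beta> (q $ 1)) has_derivative (\<lambda>v. (v $ 1) *\<^sub>R T (p $ 1))) (at p)"
  by (intro has_derivative_coord_1 deriv_\<beta> proj)

lemma derivative_T: "p \<in> U \<Longrightarrow> ((\<lambda>q::real^3. T (q $ 1)) has_derivative (\<lambda>v. (v $ 1) *\<^sub>R K (p $ 1))) (at p)"
  by (intro has_derivative_coord_1 deriv_T proj)

lemma differentiable_T: "p \<in> U \<Longrightarrow> (\<lambda>q::real^3. T (q $ 1)) differentiable (at p)"
  using derivative_T by (rule differentiableI)

lemma pd_T: "p \<in> U \<Longrightarrow> pd a (\<lambda>q. T (q $ 1)) p = (if a = 1 then K (p $ 1) else 0)"
  by (subst pd_eqI[OF derivative_T]) (auto simp: axis_def)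

lemma derivative_N:
  assumes "p \<in> U"
  shows "(N has_derivative (\<lambda>v. - \<kappa> *\<^sub>R (frechet_derivative x (at p) v - (v $ 1) *\<^sub>R T (p $ 1)))) (at p)"
proof (rule has_derivative_transform_within_open[OF _ open_U assms])
  show "((\<lambda>q. - \<kappa> *\<^sub>R (x q - \<beta> (q $ 1))) has_derivative
      (\<lambda>v. - \<kappa> *\<^sub>R (frechet_derivative x (at p) v - (v $ 1) *\<^sub>R T (p $ 1)))) (at p)"
    by (intro has_derivative_scaleR_right has_derivative_diff derivative_\<beta> assms
        differentiable_has_pd differentiable_x)
qed (simp add: N_eq)

lemma differentiable_N: "p \<in> U \<Longrightarrow> N differentiable (at p)"
  using derivative_N by (rule differentiableI)

lemma pd_N: "p \<in> U \<Longrightarrow> pd a N p = - \<kappa> *\<^sub>R (pd a x p - (if a = 1 then T (p $ 1) else 0))"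
  by (subst pd_eqI[OF derivative_N]) (auto simp: axis_def pd_def)

lemma derivative_pd_N:
  assumes "p \<in> U"
  shows "(pd b N has_derivative (\<lambda>v. - \<kappa> *\<^sub>R (frechet_derivative (pd b x) (at p) v -
    (if b = 1 then (v $ 1) *\<^sub>R K (p $ 1) else 0)))) (at p)"
proof (rule has_derivative_transform_within_open[OF _ open_U assms])
  show "((\<lambda>q. - \<kappa> *\<^sub>R (pd b x q - (if b = 1 then T (q $ 1) else 0))) has_derivative
      (\<lambda>v. - \<kappa> *\<^sub>R (frechet_derivative (pd b x) (at p) v - (if b = 1 then (v $ 1) *\<^sub>R K (p $ 1) else 0)))) (at p)"
    by (cases "b = 1") (auto intro!: has_derivative_scaleR_right has_derivative_diff has_derivative_minus derivative_T assms
        differentiable_has_pd differentiable_pd_x)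
qed (simp add: pd_N)

lemma pd_pd_N:
  assumes "p \<in> U"
  shows "pd a (pd b N) p = - \<kappa> *\<^sub>R (pd a (pd b x) p - (if a = 1 \<and> b = 1 then K (p $ 1) else 0))"
  by (subst pd_eqI[OF derivative_pd_N[OF assms]]) (auto simp: axis_def pd_def)

text \<open>Differentiate \<open>N_T\<close> and substitute \<open>pd_N\<close>; the derivative of
  \<open>T\<close> contributes the term with \<open>K\<close> in \<open>A\<close>.\<close>

lemma lprod_pd_x_T:
  assumes "p \<in> U"
  shows "lprod (pd a x p) (T (p $ 1)) = (if a = 1 then A p else 0)"
proof -
  have "0 = pd a (\<lambda>q. lprod (N q) (T (q $ 1))) p"
    by (subst pd_cong[OF open_U assms N_T]) auto
  also have "\<dots> = lprod (pd a N p) (T (p $ 1)) + lprod (N p) (pd a (\<lambda>q. T (q $ 1)) p)"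
    by (rule pd_lprod[OF differentiable_N[OF assms] differentiable_T[OF assms]])
  also have "\<dots> = - \<kappa> * lprod (pd a x p) (T (p $ 1)) + (if a = 1 then \<kappa> * A p else 0)"
    using \<kappa>_nz T_unit[OF proj[OF assms]]
    by (simp add: pd_N pd_T assms lprod.minus_left lprod.scaleR_left lprod.diff_left A_def lprod.zero_left lprod.zero_right field_simps)
  finally show ?thesis using \<kappa>_nz by (auto split: if_splits)
qed

text \<open>Differentiate the constant \<open>N_N\<close>; the term with \<open>T\<close> in
  \<open>pd_N\<close> drops out by \<open>N_T\<close>. This makes \<open>N\<close> normal to the
  hypersurface.\<close>

lemma lprod_pd_x_N:
  assumes "p \<in> U"
  shows "lprod (pd a x p) (N p) = 0"
proof -
  have "0 = pd a (\<lambda>q. lprod (N q) (N q)) p"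
    by (subst pd_cong[OF open_U assms N_N]) auto
  also have "\<dots> = lprod (pd a N p) (N p) + lprod (N p) (pd a N p)"
    by (rule pd_lprod[OF differentiable_N[OF assms] differentiable_N[OF assms]])
  also have "\<dots> = - 2 * \<kappa> * lprod (pd a x p) (N p)"
    using N_T[OF assms]
    by (simp add: pd_N assms lprod.minus_left lprod.scaleR_left lprod.diff_left lprod_commute[of "N p"] lprod.zero_left)
  finally show ?thesis using \<kappa>_nz by simp
qed

text \<open>The second fundamental form, found by differentiating
  \<open>lprod_pd_x_N\<close>.\<close>

lemma lprod_pd_pd_x_N:
  assumes "p \<in> U"
  shows "lprod (pd a (pd b x) p) (N p) =
    \<kappa> * (induced_metric x p $ a $ b - (if a = 1 \<and> b = 1 then A p else 0))"
proof -
  have "0 = pd a (\<lambda>q. lprod (pd b x q) (N q)) p"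
    by (subst pd_cong[OF open_U assms lprod_pd_x_N]) auto
  also have "\<dots> = lprod (pd a (pd b x) p) (N p) + lprod (pd b x p) (pd a N p)"
    by (rule pd_lprod[OF differentiable_pd_x[OF assms] differentiable_N[OF assms]])
  also have "lprod (pd b x p) (pd a N p) =
      - (\<kappa> * (induced_metric x p $ a $ b - (if a = 1 \<and> b = 1 then A p else 0)))"
    by (simp add: pd_N assms lprod.minus_right lprod.scaleR_right lprod.diff_right lprod_pd_x_T
        induced_metric_def lprod.zero_right algebra_simps lprod_commute[of "pd b x p" "pd a x p"])
  finally show ?thesis by simp
qed

section \<open>The frame of coordinate fields and normal, and the inverse metric\<close>

lemma orthogonal_to_frame:
  assumes "p \<in> U" and y: "\<And>a. lprod y (pd a x p) = 0" "lprod y (N p) = 0"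
  shows "y = 0"
proof (rule orthogonal_to_independent)
  fix a b c d
  assume z: "a *\<^sub>R pd 1 x p + b *\<^sub>R pd 2 x p + c *\<^sub>R pd 3 x p + d *\<^sub>R N p = 0"
  \<comment> \<open>The normal is not null, so pairing with it isolates \<open>d\<close>; the
    immersion property then handles the tangential coefficients.\<close>
  have "lprod (a *\<^sub>R pd 1 x p + b *\<^sub>R pd 2 x p + c *\<^sub>R pd 3 x p + d *\<^sub>R N p) (N p) = d * \<epsilon>"
    by (simp add: lprod.add_left lprod.scaleR_left lprod_pd_x_N N_N assms(1))
  with z \<epsilon>_sq have d: "d = 0" by (auto simp: lprod.zero_left)
  have "frechet_derivative x (at p) (vector [a, b, c]) = 0"
    using z d by (simp add: frechet_derivative_eq_sum_pd differentiable_x assms(1) sum_3)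
  moreover have "inj (frechet_derivative x (at p))" "linear (frechet_derivative x (at p))"
    using imm assms(1) linear_frechet_derivative differentiable_x by (auto simp: immersion_on_def)
  ultimately have "vector [a, b, c] = (0 :: real^3)" using linear_injective_0 by blast
  with d show "a = 0 \<and> b = 0 \<and> c = 0 \<and> d = 0" by (simp add: vec_eq_iff forall_3)
qed (use y in auto)

text \<open>A kernel vector of the metric gives a tangent vector orthogonal to all tangent vectors
  and to \<open>N\<close>, hence zero; injectivity of the differential carries this back to the
  parameters.\<close>

lemma metric_inverse:
  assumes "p \<in> U"
  shows "matrix_inv (induced_metric x p) ** induced_metric x p = mat 1"
    and "induced_metric x p ** matrix_inv (induced_metric x p) = mat 1"
proof -
  have "v = 0" if "induced_metric x p *v v = 0" for v
  proof -
    define y where "y = (\<Sum>b\<in>UNIV. v $ b *\<^sub>R pd b x p)"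
    have "lprod (pd a x p) y = (induced_metric x p *v v) $ a" for a
      by (simp add: y_def lprod.sum_right lprod.scaleR_right matrix_vector_mult_def induced_metric_def
          mult.commute)
    moreover have "lprod y (N p) = 0"
      by (simp add: y_def lprod.sum_left lprod.scaleR_left lprod_pd_x_N assms)
    ultimately have "y = 0" using orthogonal_to_frame[OF assms] that by (simp add: lprod_commute[of y])
    hence "frechet_derivative x (at p) v = 0"
      by (simp add: frechet_derivative_eq_sum_pd differentiable_x assms y_def)
    moreover have "inj (frechet_derivative x (at p))" "linear (frechet_derivative x (at p))"
      using imm assms(1) linear_frechet_derivative differentiable_x by (auto simp: immersion_on_def)
    ultimately show ?thesis using linear_injective_0 by blast
  qed
  from matrix_inv_works[OF this] show
    "matrix_inv (induced_metric x p) ** induced_metric x p = mat 1"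
    "induced_metric x p ** matrix_inv (induced_metric x p) = mat 1" by auto
qed

text \<open>Both sides have the same products with the coordinate fields and with \<open>N\<close>;
  \<epsilon> is its own inverse.\<close>

lemma frame_decomposition:
  assumes "p \<in> U"
  shows "y = (\<Sum>c\<in>UNIV. (\<Sum>d\<in>UNIV. matrix_inv (induced_metric x p) $ c $ d * lprod y (pd d x p)) *\<^sub>R pd c x p)
    + (\<epsilon> * lprod y (N p)) *\<^sub>R N p" (is "y = ?z")
proof -
  let ?G = "induced_metric x p" and ?u = "\<chi> d. lprod y (pd d x p)"
  have G: "lprod (pd a x p) (pd b x p) = ?G $ a $ b" for a b
    by (simp add: induced_metric_def)
  have "lprod (pd a x p) ?z = (?G *v (matrix_inv ?G *v ?u)) $ a" for a
    unfolding lprod.add_right lprod.sum_right lprod.scaleR_right G lprod_pd_x_N[OF assms]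
    by (simp add: matrix_vector_mult_def mult.commute)
  hence "lprod (y - ?z) (pd a x p) = 0" for a
    by (simp add: matrix_vector_mul_assoc metric_inverse assms lprod.diff_left lprod_commute[of ?z])
  moreover have "lprod (y - ?z) (N p) = 0"
    using \<epsilon>_sq by (simp add: lprod.sum_left lprod.scaleR_left lprod.add_left lprod.diff_left lprod_pd_x_N N_N assms algebra_simps)
  ultimately have "y - ?z = 0" using orthogonal_to_frame[OF assms] by blast
  thus ?thesis by simp
qed

text \<open>\<open>T\<close> is tangent, and only its product with the first coordinate field is
  nonzero, namely \<open>A p\<close>. Its expansion therefore uses only the first column of the
  inverse metric, and its unit length gives both claims.\<close>

lemma inverse_metric_11:
  assumes "p \<in> U"
  shows "A p \<noteq> 0" "matrix_inv (induced_metric x p) $ 1 $ 1 = 1 / (A p)\<^sup>2"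
proof -
  let ?T = "T (p $ 1)" and ?Gi = "matrix_inv (induced_metric x p)"
  have "?T = (\<Sum>c\<in>UNIV. (?Gi $ c $ 1 * A p) *\<^sub>R pd c x p)"
    using frame_decomposition[OF assms, of ?T] N_T[OF assms]
    by (simp add: lprod_commute[of ?T] lprod_pd_x_T assms if_distrib cong: if_cong)
  from arg_cong[OF this, of "\<lambda>v. lprod v ?T"]
  have "lprod ?T ?T = (\<Sum>c\<in>UNIV. ?Gi $ c $ 1 * A p * lprod (pd c x p) ?T)"
    by (simp only: lprod.sum_left lprod.scaleR_left real_scaleR_def)
  hence *: "1 = ?Gi $ 1 $ 1 * A p * A p"
    using T_unit[OF proj[OF assms]] by (simp add: lprod_pd_x_T assms if_distrib cong: if_cong)
  thus "A p \<noteq> 0" by auto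
  with * show "?Gi $ 1 $ 1 = 1 / (A p)\<^sup>2" by (simp add: field_simps power2_eq_square)
qed

section \<open>Gauss formula, Hessian, shape operator and the Cheng-Yau operator\<close>

lemma christoffel_eq:
  assumes "p \<in> U"
  shows "christoffel x c a b p =
    (\<Sum>d\<in>UNIV. matrix_inv (induced_metric x p) $ c $ d * lprod (pd a (pd b x) p) (pd d x p))"
proof -
  have m: "pd a (\<lambda>q. induced_metric x q $ b $ d) p =
      lprod (pd a (pd b x) p) (pd d x p) + lprod (pd b x p) (pd a (pd d x) p)" for a b d
    by (simp add: induced_metric_def pd_lprod[OF differentiable_pd_x[OF assms] differentiable_pd_x[OF assms]])
  have c: "pd a (pd b x) p = pd b (pd a x) p" for a b
    by (rule pd_commute[OF open_U assms smooth_x])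
  \<comment> \<open>Each metric derivative is a sum of two products; by symmetry of second
    derivatives four of the six cancel.\<close>
  have "pd a (\<lambda>q. induced_metric x q $ b $ d) p + pd b (\<lambda>q. induced_metric x q $ a $ d) p
      - pd d (\<lambda>q. induced_metric x q $ a $ b) p = 2 * lprod (pd a (pd b x) p) (pd d x p)" for d
    unfolding m c[of d a] c[of d b] c[of b a]
    by (simp add: lprod_commute)
  thus ?thesis
    by (simp add: christoffel_def sum_distrib_left mult.left_commute)
qed

lemma gauss_formula:
  assumes "p \<in> U"
  shows "pd a (pd b x) p = (\<Sum>c\<in>UNIV. christoffel x c a b p *\<^sub>R pd c x p)
    + (\<epsilon> * lprod (pd a (pd b x) p) (N p)) *\<^sub>R N p"
  using frame_decomposition[OF assms, of "pd a (pd b x) p"] by (simp add: christoffel_eq assms)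

text \<open>By the Gauss formula the part of \<open>N\<close> coming from \<open>x\<close> leaves
  only a normal term. The curve depends on \<open>s\<close> alone, so it adds \<open>K\<close> in
  the entry (1,1) and the Christoffel symbols with upper index 1 along \<open>T\<close>.\<close>

lemma hessian_N:
  assumes "p \<in> U"
  shows "hessian x (\<lambda>q. N q $ i) p =
    (- \<kappa> * \<epsilon> * N p $ i) *\<^sub>R (\<chi> a b. - lprod (pd a x p) (pd b N p))
    + (\<kappa> * K (p $ 1) $ i) *\<^sub>R (\<chi> a b. if a = 1 \<and> b = 1 then 1 else 0)
    + (- \<kappa> * T (p $ 1) $ i) *\<^sub>R (\<chi> a b. christoffel x 1 a b p)"
proof -
  have h: "- lprod (pd a x p) (pd b N p) = lprod (pd a (pd b x) p) (N p)" for a b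
    by (simp add: pd_N assms lprod.minus_right lprod.scaleR_right lprod.diff_right lprod_pd_x_T
        induced_metric_def lprod.zero_right algebra_simps lprod_pd_pd_x_N)
  have 1: "pd b (\<lambda>q. N q $ i) q = pd b N q $ i" if "q \<in> U" for b q
    by (rule pd_component[OF differentiable_N[OF that]])
  have 2: "pd a (pd b (\<lambda>q. N q $ i)) p = pd a (pd b N) p $ i" for a b
    using pd_cong[OF open_U assms 1] pd_component[OF differentiableI[OF derivative_pd_N[OF assms]]] by simp
  have "pd a (pd b N) p - (\<Sum>c\<in>UNIV. christoffel x c a b p *\<^sub>R pd c N p) =
      (- \<kappa> * \<epsilon> * lprod (pd a (pd b x) p) (N p)) *\<^sub>R N p
      + (if a = 1 \<and> b = 1 then \<kappa> *\<^sub>R K (p $ 1) else 0) - (\<kappa> * christoffel x 1 a b p) *\<^sub>R T (p $ 1)" for a b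
  proof -
    have s: "(\<Sum>c\<in>UNIV. christoffel x c a b p *\<^sub>R pd c N p) =
        - \<kappa> *\<^sub>R (\<Sum>c\<in>UNIV. christoffel x c a b p *\<^sub>R pd c x p) + (\<kappa> * christoffel x 1 a b p) *\<^sub>R T (p $ 1)"
      by (simp add: pd_N assms sum_3 algebra_simps)
    have "pd a (pd b N) p - (\<Sum>c\<in>UNIV. christoffel x c a b p *\<^sub>R pd c N p) =
        - \<kappa> *\<^sub>R (pd a (pd b x) p - (\<Sum>c\<in>UNIV. christoffel x c a b p *\<^sub>R pd c x p))
        + (if a = 1 \<and> b = 1 then \<kappa> *\<^sub>R K (p $ 1) else 0) - (\<kappa> * christoffel x 1 a b p) *\<^sub>R T (p $ 1)"
      unfolding s pd_pd_N[OF assms] by (simp add: algebra_simps)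
    also have "pd a (pd b x) p - (\<Sum>c\<in>UNIV. christoffel x c a b p *\<^sub>R pd c x p) =
        (\<epsilon> * lprod (pd a (pd b x) p) (N p)) *\<^sub>R N p"
      using gauss_formula[OF assms, of a b] by (simp add: algebra_simps)
    finally show ?thesis by simp
  qed
  from arg_cong[OF this, of "\<lambda>v. v $ i"] show ?thesis
    by (simp add: hessian_def vec_eq_iff 1 2 assms h[simplified] if_distrib[of "\<lambda>v. v $ i"] mult_ac)
qed

text \<open>The inner \<open>\<chi> c\<close> presents the first column of the inverse metric as a
  vector, so that the right-hand side has the form of \<open>S\<close> in
  \<open>newton_traces\<close>.\<close>

lemma shape_operator:
  assumes "p \<in> U"
  shows "shape_op x N p = (\<chi> a b. \<kappa> * ((if a = b then 1 else 0)
    - (if b = 1 then A p * (\<chi> c. matrix_inv (induced_metric x p) $ c $ 1) $ a else 0)))"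
proof -
  let ?G = "induced_metric x p"
  have h: "- lprod (pd a x p) (pd b N p) = \<kappa> * (?G $ a $ b - (if a = 1 then (if b = 1 then A p else 0) else 0))" for a b
    by (simp add: pd_N assms lprod.minus_right lprod.scaleR_right lprod.diff_right lprod_pd_x_T
        induced_metric_def lprod.zero_right algebra_simps)
  have "(\<Sum>c\<in>UNIV. matrix_inv ?G $ a $ c * ?G $ c $ b) = (if a = b then 1 else 0)" for a b
    using arg_cong[OF metric_inverse(1)[OF assms], of "\<lambda>M. M $ a $ b"]
    by (simp add: matrix_matrix_mult_def mat_def)
  moreover have "(\<Sum>c\<in>UNIV. matrix_inv ?G $ a $ c * (\<kappa> * (?G $ c $ b - (if c = 1 then (if b = 1 then A p else 0) else 0))))
      = \<kappa> * ((\<Sum>c\<in>UNIV. matrix_inv ?G $ a $ c * ?G $ c $ b) - (if b = 1 then A p * matrix_inv ?G $ a $ 1 else 0))" for a b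
    by (simp add: sum_3 algebra_simps)
  ultimately show ?thesis
    by (simp add: shape_op_def matrix_matrix_mult_def h vec_eq_iff)
qed

text \<open>Left as an unevaluated trace: products with the other frame vectors do not see it, and
  the product with \<open>T\<close> is taken only when \<open>K\<close> vanishes.\<close>

definition T_coeff :: "real^3 \<Rightarrow> real" where
  "T_coeff p = - \<kappa> * trace (newton1 x N p ** (matrix_inv (induced_metric x p) ** (\<chi> a b. christoffel x 1 a b p)))"

theorem L1_gauss_map:
  assumes "p \<in> U"
  shows "L1 x N N p = (\<epsilon> * \<kappa> ^ 3 * (6 - 4 / A p)) *\<^sub>R N p
    - (2 * \<kappa>\<^sup>2 / (A p)\<^sup>2) *\<^sub>R K (p $ 1) + T_coeff p *\<^sub>R T (p $ 1)"
proof -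
  let ?Gi = "matrix_inv (induced_metric x p)" and ?S = "shape_op x N p"
  let ?J = "?Gi ** (\<chi> a b. if a = 1 \<and> b = 1 then 1 else 0)"
  have J: "?J = (\<chi> a b. if b = 1 then (\<chi> c. ?Gi $ c $ 1) $ a else 0)"
    by (simp add: vec_eq_iff matrix_matrix_mult_def sum_3 forall_3)
  \<comment> \<open>The three summands of \<open>hessian_N\<close> are traced separately; the first,
    multiplied by the inverse metric, is the shape operator itself.\<close>
  note t = newton_traces[of "\<chi> c. ?Gi $ c $ 1" "A p" \<kappa>, folded shape_operator[OF assms] J newton1_def]
  have t1: "trace (newton1 x N p ** ?S) = \<kappa>\<^sup>2 * (4 / A p - 6)"
    and t2: "trace (newton1 x N p ** ?J) = - 2 * \<kappa> / (A p)\<^sup>2"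
    using t inverse_metric_11[OF assms] by auto
  have "L1_real x N (\<lambda>q. N q $ i) p =
      (- \<kappa> * \<epsilon> * N p $ i) * (\<kappa>\<^sup>2 * (4 / A p - 6)) + (\<kappa> * K (p $ 1) $ i) * (- 2 * \<kappa> / (A p)\<^sup>2)
      + T_coeff p * T (p $ 1) $ i" for i
    unfolding L1_real_def hessian_N[OF assms] trace_mul_mul_linear t2
    unfolding shape_op_def[symmetric] t1 by (simp add: T_coeff_def)
  thus ?thesis
    by (simp add: L1_def vec_eq_iff algebra_simps power2_eq_square power3_eq_cube)
qed

text \<open>If \<open>K\<close> vanishes, then \<open>T\<close> and its products with the coordinate
  fields have zero derivative. So second derivatives of \<open>x\<close> are orthogonal to
  \<open>T\<close>, and by the Gauss formula that product is the Christoffel symbol with upper index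
  1.\<close>

lemma T_coeff_zero:
  assumes "p \<in> U" and K0: "\<And>s. s \<in> I \<Longrightarrow> K s = 0"
  shows "T_coeff p = 0"
proof -
  have A1: "A q = 1" if "q \<in> U" for q using K0[OF proj[OF that]] by (simp add: A_def lprod.zero_right)
  have "christoffel x 1 a b p = 0" for a b
  proof -
    have "0 = pd a (\<lambda>q. lprod (pd b x q) (T (q $ 1))) p"
      by (subst pd_cong[OF open_U assms(1), where g = "\<lambda>_. if b = 1 then 1 else 0"])
        (simp_all add: lprod_pd_x_T A1)
    also have "\<dots> = lprod (pd a (pd b x) p) (T (p $ 1)) + lprod (pd b x p) (pd a (\<lambda>q. T (q $ 1)) p)"
      by (rule pd_lprod[OF differentiable_pd_x[OF assms(1)] differentiable_T[OF assms(1)]])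
    also have "\<dots> = lprod (pd a (pd b x) p) (T (p $ 1))"
      using K0[OF proj[OF assms(1)]] by (simp add: pd_T assms(1) lprod.zero_right)
    also have "\<dots> = christoffel x 1 a b p"
      by (subst gauss_formula[OF assms(1)])
        (simp add: lprod.add_left lprod.sum_left lprod.scaleR_left lprod_pd_x_T N_T assms(1) A1 sum_3)
    finally show ?thesis by simp
  qed
  thus ?thesis by (simp add: T_coeff_def matrix_matrix_mult_def trace_def)
qed

end


section \<open>Rigidity on the slices of constant s\<close>

text \<open>Here \<open>nu i\<close> stands for the product of \<open>N\<close> with
  \<open>F i\<close>, \<open>c2\<close>, \<open>c3\<close>, \<open>c4\<close> for those of
  \<open>C\<close>, and \<open>k\<close> for the first curvature at the fixed \<open>s\<close>; the
  equations are the frame components of the 1-type condition.\<close>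

lemma slice_rigidity:
  fixes \<kappa> \<epsilon> \<eta> k c2 c3 c4 :: real and l :: int
  assumes j: "j \<in> {2, 3, 4}" and l: "l \<in> {1, - 1}"
    and VW: "open V" "open W" "V \<noteq> {}" "W \<noteq> {}" "connected V" "connected W"
    and nz: "\<kappa> \<noteq> 0" "\<epsilon> = of_int l" "\<eta>\<^sup>2 = 1"
  defines "e \<equiv> \<lambda>i. if i = j then -1 else (1::real)"
  defines "nu \<equiv> \<lambda>i t w. \<eta> * e i * mu j l i t w"
  defines "A \<equiv> \<lambda>t w. 1 + k * nu 2 t w / \<kappa>"
  assumes A: "\<And>t w. t \<in> V \<Longrightarrow> w \<in> W \<Longrightarrow> A t w \<noteq> 0"
    and eq2: "\<And>t w. t \<in> V \<Longrightarrow> w \<in> W \<Longrightarrow> \<epsilon> * \<kappa> ^ 3 * (6 - 4 / A t w) * nu 2 t w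
      - 2 * \<kappa>\<^sup>2 / (A t w)\<^sup>2 * (k * e 2) = m t w * (nu 2 t w + c2)"
    and eq3: "\<And>t w. t \<in> V \<Longrightarrow> w \<in> W \<Longrightarrow> \<epsilon> * \<kappa> ^ 3 * (6 - 4 / A t w) * nu 3 t w = m t w * (nu 3 t w + c3)"
    and eq4: "\<And>t w. t \<in> V \<Longrightarrow> w \<in> W \<Longrightarrow> \<epsilon> * \<kappa> ^ 3 * (6 - 4 / A t w) * nu 4 t w = m t w * (nu 4 t w + c4)"
  shows "k = 0" "c2 = 0" "c3 = 0" "c4 = 0" "\<exists>t\<in>V. \<exists>w\<in>W. m t w = 2 * \<epsilon> * \<kappa> ^ 3"
proof -
  note indep = mu_affine_independent[OF j l VW(1-4)]
  have e: "e i \<noteq> 0" for i by (simp add: e_def)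
  have \<eta>: "\<eta> \<noteq> 0" and \<epsilon>: "\<epsilon> \<noteq> 0" using nz l by auto
  \<comment> \<open>Cross-multiplying \<open>eq3\<close> and \<open>eq4\<close> eliminates their
    common left factor. Where \<open>m\<close> vanishes, both sides are shown to be zero
    instead.\<close>
  have "c3 * nu 4 t w = c4 * nu 3 t w" if tw: "t \<in> V" "w \<in> W" for t w
  proof (cases "m t w = 0")
    case False
    have "m t w * (c3 * nu 4 t w - c4 * nu 3 t w) =
        (m t w * (nu 3 t w + c3)) * nu 4 t w - (m t w * (nu 4 t w + c4)) * nu 3 t w"
      by (simp add: algebra_simps)
    also have "\<dots> = 0" unfolding eq3[OF tw, symmetric] eq4[OF tw, symmetric] by simp
    finally show ?thesis using False by simp
  next
    case True
    \<comment> \<open>Otherwise the common factor would vanish, \<open>eq2\<close> would force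
      \<open>k = 0\<close>, and then the factor would be
      \<open>2 * \<epsilon> * \<kappa> ^ 3\<close>.\<close>
    have "nu 3 t w = 0 \<and> nu 4 t w = 0"
    proof (rule ccontr)
      assume "\<not> ?thesis"
      hence D: "\<epsilon> * \<kappa> ^ 3 * (6 - 4 / A t w) = 0"
        using eq3[OF tw] eq4[OF tw] True by auto
      hence "k = 0" using eq2[OF tw, unfolded D True] A[OF tw] nz(1) e[of 2] by simp
      hence "A t w = 1" by (simp add: A_def)
      with D show False using \<epsilon> nz by simp
    qed
    thus ?thesis by simp
  qed
  hence "0 = c4 * \<eta> * e 3 \<and> 0 = c3 * \<eta> * e 4"
    using indep[of 0 0 "- (c4 * \<eta> * e 3)" "c3 * \<eta> * e 4"] by (auto simp: nu_def mult_ac)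
  thus c34: "c3 = 0" "c4 = 0" using \<eta> e[of 3] e[of 4] by auto
  obtain t1 w1 where tw1: "t1 \<in> V" "w1 \<in> W" "nu 3 t1 w1 \<noteq> 0"
    using indep[of 0 0 1 0] \<eta> e[of 3] by (auto simp: nu_def)
  have m: "m t w = \<epsilon> * \<kappa> ^ 3 * (6 - 4 / A t w)"
    if "t \<in> V" "w \<in> W" "nu 3 t w \<noteq> 0 \<or> nu 4 t w \<noteq> 0" for t w
    using eq3[OF that(1,2)] eq4[OF that(1,2)] that(3) by (auto simp: c34)
  \<comment> \<open>Here \<open>m\<close> equals the factor of \<open>nu 2 t w\<close> on the left
    of \<open>eq2\<close>, so these terms cancel; what remains is multiplied by the square of
    \<open>A\<close>.\<close>
  have quad: "\<epsilon> * \<kappa> * (6 * (A t w)\<^sup>2 - 4 * A t w) * c2 = - 2 * k * e 2"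
    if "t \<in> V" "w \<in> W" "nu 3 t w \<noteq> 0 \<or> nu 4 t w \<noteq> 0" for t w
  proof -
    have "- (2 * \<kappa>\<^sup>2 / (A t w)\<^sup>2 * (k * e 2)) = \<epsilon> * \<kappa> ^ 3 * (6 - 4 / A t w) * c2"
      using eq2[OF that(1,2)] unfolding m[OF that] distrib_left by linarith
    hence "\<kappa>\<^sup>2 * (\<epsilon> * \<kappa> * (6 * (A t w)\<^sup>2 - 4 * A t w) * c2) = \<kappa>\<^sup>2 * (- 2 * k * e 2)"
      using A[OF that(1,2)] by (simp add: field_simps power2_eq_square power3_eq_cube)
    thus ?thesis unfolding mult_cancel_left using nz(1) by simp
  qed
  have c2_k: "c2 = 0 \<longleftrightarrow> k = 0"
  proof
    assume "c2 = 0" thus "k = 0" using quad[OF tw1(1,2)] tw1(3) e[of 2] by auto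
  next
    assume k: "k = 0"
    hence "A t1 w1 = 1" by (simp add: A_def)
    with quad[OF tw1(1,2)] tw1(3) k \<epsilon> nz(1) show "c2 = 0" by auto
  qed
  show k: "k = 0"
  proof (rule ccontr)
    assume k: "k \<noteq> 0"
    define q where "q = [:2 * \<epsilon> * \<kappa> * c2 + 2 * k * e 2, 8 * \<epsilon> * c2 * k, 6 * \<epsilon> * c2 * k\<^sup>2 / \<kappa>:]"
    have "q \<noteq> 0" using k c2_k \<epsilon> nz(1) by (simp add: q_def)
    hence fin: "finite ({y. poly q y = 0} \<union> {1, - 1})" by (simp add: poly_roots_finite)
    have range: "nu 2 t w \<in> {y. poly q y = 0} \<union> {1, - 1}" if tw: "t \<in> V" "w \<in> W" for t w
    proof (cases "nu 3 t w = 0 \<and> nu 4 t w = 0")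
      case True
      hence "e 2 * (mu j l 2 t w)\<^sup>2 = of_int l"
        using mu_quadric[OF j l, of t w] \<eta> e by (auto simp: nu_def e_def)
      moreover have "e 2 = 1 \<or> e 2 = -1" by (simp add: e_def)
      ultimately have "(mu j l 2 t w)\<^sup>2 = 1 \<or> (mu j l 2 t w)\<^sup>2 = -1" using l by auto
      hence "(mu j l 2 t w)\<^sup>2 = 1" using zero_le_power2[of "mu j l 2 t w"] by linarith
      hence "(nu 2 t w)\<^sup>2 = 1" using nz(3) by (simp add: nu_def power_mult_distrib e_def)
      thus ?thesis by (auto simp: power2_eq_1_iff)
    next
      case False
      have "poly q (nu 2 t w) = \<epsilon> * \<kappa> * (6 * (A t w)\<^sup>2 - 4 * A t w) * c2 + 2 * k * e 2"
        using nz(1) by (simp add: q_def A_def field_simps power2_eq_square)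
      thus ?thesis using quad[OF tw] False by auto
    qed
    \<comment> \<open>A continuous function with finite range on a connected set is constant,
      contradicting affine independence.\<close>
    have "(\<lambda>z. nu 2 (fst z) (snd z)) constant_on (V \<times> W)"
    proof (rule continuous_finite_range_constant)
      show "connected (V \<times> W)" using VW by (simp add: connected_Times)
      show "continuous_on (V \<times> W) (\<lambda>z. nu 2 (fst z) (snd z))"
        unfolding nu_def by (intro continuous_intros continuous_on_mu l)
      show "finite ((\<lambda>z. nu 2 (fst z) (snd z)) ` (V \<times> W))"
        by (rule finite_subset[OF _ fin]) (intro image_subsetI range; auto)
    qed
    then obtain y where "nu 2 t w = y" if "t \<in> V" "w \<in> W" for t w
      unfolding constant_on_def by force
    hence "\<eta> * e 2 = 0" using indep[of "- y" "\<eta> * e 2" 0 0] by (auto simp: nu_def)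
    thus False using \<eta> e[of 2] by simp
  qed
  with c2_k show "c2 = 0" by simp
  show "\<exists>t\<in>V. \<exists>w\<in>W. m t w = 2 * \<epsilon> * \<kappa> ^ 3"
    using m[OF tw1(1,2)] tw1 by (intro bexI[of _ t1] bexI[of _ w1]) (simp_all add: A_def k)
qed

lemma open_slice:
  fixes U :: "(real^3) set"
  assumes "open U" "p \<in> U"
  obtains V W where "open V" "open W" "p $ 2 \<in> V" "p $ 3 \<in> W" "connected V" "connected W"
    "\<And>t w. t \<in> V \<Longrightarrow> w \<in> W \<Longrightarrow> vector [p $ 1, t, w] \<in> U"
proof -
  obtain d where d: "d > 0" "ball p d \<subseteq> U" using assms open_contains_ball by blast
  \<comment> \<open>Two coordinates vary, and the norm is at most the sum of their deviations, so
    each gets half the radius.\<close>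
  have "vector [p $ 1, t, w] \<in> U" if "t \<in> ball (p $ 2) (d / 2)" "w \<in> ball (p $ 3) (d / 2)" for t w
  proof -
    have "\<bar>t - p $ 2\<bar> < d / 2" "\<bar>w - p $ 3\<bar> < d / 2"
      using that by (simp_all add: dist_real_def abs_minus_commute)
    moreover have "norm (vector [p $ 1, t, w] - p) \<le> (\<Sum>i\<in>UNIV. \<bar>(vector [p $ 1, t, w] - p) $ i\<bar>)"
      by (rule norm_le_l1_cart)
    ultimately have "norm (vector [p $ 1, t, w] - p) < d" by (simp add: sum_3)
    hence "dist p (vector [p $ 1, t, w]) < d" by (simp add: dist_norm norm_minus_commute)
    thus ?thesis using d by auto
  qed
  with d(1) show ?thesis
    by (intro that[of "ball (p $ 2) (d / 2)" "ball (p $ 3) (d / 2)"]) auto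
qed

section \<open>Tubular hypersurfaces as canal hypersurfaces, and the contradiction\<close>

theorem theorem10:
  fixes j :: nat and l :: int and r :: real and I :: "real set" and U :: "(real^3) set"
    and \<beta> :: "real \<Rightarrow> real^4" and F :: "nat \<Rightarrow> real \<Rightarrow> real^4" and k :: "nat \<Rightarrow> real \<Rightarrow> real"
  assumes "j \<in> {2, 3, 4}" and "l \<in> {1, -1}" and "r > 0"
    and "open I" and "is_interval I" and "I \<noteq> {}"
    and "frenet_curve j I \<beta> F k"
    and "open U" and "connected U" and "(\<lambda>p. p $ 1) ` U = I"
    and "immersion_on U (tubular j l r \<beta> F)"
  shows "\<not> second_kind_L1_pointwise_1_type_Gauss_map U (tubular j l r \<beta> F) (tubular_gauss j l F)"
proof
  note j = assms(1) and l = assms(2) and r = assms(3)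
  define x where "x = tubular j l r \<beta> F"
  define N where "N = tubular_gauss j l F"
  define \<eta> :: real where "\<eta> = - ((-1) ^ fact (4 - j)) * of_int l ^ j"
  \<comment> \<open>Chosen so that the Gauss map is -\<kappa> times the radius vector
    \<open>x - \<beta>\<close>, as the locale requires.\<close>
  define \<kappa> where "\<kappa> = - \<eta> / r"
  define \<epsilon> :: real where "\<epsilon> = of_int l"
  define k1 where "k1 = k 1"
  define e where "e i = (if i = j then -1 else (1::real))" for i
  have \<eta>: "\<eta>\<^sup>2 = 1" using l by (auto simp: \<eta>_def power_mult_distrib simp flip: power_mult)
  hence \<eta>0: "\<eta> \<noteq> 0" by auto
  have \<kappa>: "\<kappa> \<noteq> 0" using \<eta>0 r by (simp add: \<kappa>_def)
  have \<epsilon>: "\<epsilon> * \<epsilon> = 1" using l by (auto simp: \<epsilon>_def)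
  have proj: "p $ 1 \<in> I" if "p \<in> U" for p using that assms(10) by blast
  have F: "lprod (F a s) (F b s) = (if a \<noteq> b then 0 else e a)" if "s \<in> I" "a \<in> {1..4}" "b \<in> {1..4}" for a b s
    using assms(7) that by (auto simp: frenet_curve_def e_def)
  have e1: "e 1 = 1" using j by (auto simp: e_def)
  have sum: "(\<Sum>i=2..4. f i) = f 2 + f 3 + f (4::nat)" for f :: "nat \<Rightarrow> real^4"
  proof -
    have "{2..4::nat} = {2, 3, 4}" by auto
    thus ?thesis by simp
  qed
  have N: "N q = (\<eta> * mu j l 2 (q $ 2) (q $ 3)) *\<^sub>R F 2 (q $ 1) + (\<eta> * mu j l 3 (q $ 2) (q $ 3)) *\<^sub>R F 3 (q $ 1)
      + (\<eta> * mu j l 4 (q $ 2) (q $ 3)) *\<^sub>R F 4 (q $ 1)" for q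
    by (simp add: N_def tubular_gauss_def \<eta>_def sum scaleR_add_right)
  have N_F: "lprod (N q) (F i (q $ 1)) = \<eta> * e i * mu j l i (q $ 2) (q $ 3)" if "q \<in> U" "i \<in> {2, 3, 4}" for q i
    using that F[OF proj[OF that(1)]] by (auto simp: N lprod.add_left lprod.scaleR_left)
  have N_F1: "lprod (N q) (F 1 (q $ 1)) = 0" if "q \<in> U" for q
    using that F[OF proj[OF that(1)]] by (auto simp: N lprod.add_left lprod.scaleR_left)
  have N_N: "lprod (N q) (N q) = \<epsilon>" if "q \<in> U" for q
  proof -
    have "lprod (N q) (N q) = \<eta>\<^sup>2 * (e 2 * (mu j l 2 (q $ 2) (q $ 3))\<^sup>2 + e 3 * (mu j l 3 (q $ 2) (q $ 3))\<^sup>2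
        + e 4 * (mu j l 4 (q $ 2) (q $ 3))\<^sup>2)"
      using F[OF proj[OF that(1)]]
      by (simp add: N lprod.add_left lprod.scaleR_left lprod.add_right lprod.scaleR_right
          power2_eq_square algebra_simps)
    thus ?thesis using mu_quadric[OF j l] \<eta> by (simp add: \<epsilon>_def e_def)
  qed
  have F1': "(F 1 has_vector_derivative k1 s *\<^sub>R F 2 s) (at s)" if "s \<in> I" for s
    using assms(7) that j by (auto simp: k1_def frenet_curve_def frenet_equations_def)
  interpret canal_hypersurface U I x N \<beta> "F 1" "\<lambda>s. k1 s *\<^sub>R F 2 s" \<kappa> \<epsilon>
  proof
    fix q assume "q \<in> U"
    show "N q = - \<kappa> *\<^sub>R (x q - \<beta> (q $ 1))"
      using r by (simp add: \<kappa>_def N x_def tubular_def sum scaleR_add_right)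
  qed (use assms proj F1' F e1 \<kappa> \<epsilon> N_N N_F1 in \<open>auto simp: x_def frenet_curve_def\<close>)
  assume "second_kind_L1_pointwise_1_type_Gauss_map U (tubular j l r \<beta> F) (tubular_gauss j l F)"
  then obtain m C where "C \<noteq> 0" and L1: "\<And>p. p \<in> U \<Longrightarrow> L1 x N N p = m p *\<^sub>R (N p + C)"
    unfolding second_kind_L1_pointwise_1_type_Gauss_map_def x_def N_def by blast
  \<comment> \<open>The assumed equation, paired with \<open>F i\<close>.\<close>
  have comp: "(\<epsilon> * \<kappa> ^ 3 * (6 - 4 / A p)) * lprod (N p) (F i (p $ 1))
      - 2 * \<kappa>\<^sup>2 / (A p)\<^sup>2 * (k1 (p $ 1) * lprod (F 2 (p $ 1)) (F i (p $ 1)))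
      + T_coeff p * lprod (F 1 (p $ 1)) (F i (p $ 1))
      = m p * (lprod (N p) (F i (p $ 1)) + lprod C (F i (p $ 1)))" if "p \<in> U" for p i
    using arg_cong[OF trans[OF L1_gauss_map[OF that, symmetric] L1[OF that]], of "\<lambda>v. lprod v (F i (p $ 1))"]
    by (simp add: lprod.add_left lprod.diff_left lprod.scaleR_left)
  have slice: "k1 s = 0 \<and> lprod C (F 2 s) = 0 \<and> lprod C (F 3 s) = 0 \<and> lprod C (F 4 s) = 0 \<and>
      (\<exists>p\<in>U. p $ 1 = s \<and> m p \<noteq> 0)" if "s \<in> I" for s
  proof -
    obtain p where p: "p \<in> U" "p $ 1 = s" using \<open>s \<in> I\<close> assms(10) by blast
    obtain V W where VW: "open V" "open W" "p $ 2 \<in> V" "p $ 3 \<in> W" "connected V" "connected W"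
      and inU: "\<And>t w. t \<in> V \<Longrightarrow> w \<in> W \<Longrightarrow> vector [s, t, w] \<in> U"
      using open_slice[OF open_U p(1)] unfolding p(2) by metis
    have A: "A (vector [s, t, w]) = 1 + k1 s * (\<eta> * e 2 * mu j l 2 t w) / \<kappa>" if "t \<in> V" "w \<in> W" for t w
      using N_F[OF inU[OF that], of 2] unfolding A_def by (simp add: lprod.scaleR_right)
    have ne: "V \<noteq> {}" "W \<noteq> {}" using VW by auto
    have s1: "lprod (F a s) (F b s) = (if a \<noteq> b then 0 else e a)" if "a \<in> {1..4}" "b \<in> {1..4}" for a b
      using F[OF \<open>s \<in> I\<close> that] .
    note * = slice_rigidity[OF j l VW(1,2) ne VW(5,6) \<kappa> \<epsilon>_def \<eta>, where k = "k1 s" and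
        m = "\<lambda>t w. m (vector [s, t, w])" and ?c2.0 = "lprod C (F 2 s)" and ?c3.0 = "lprod C (F 3 s)"
        and ?c4.0 = "lprod C (F 4 s)", folded e_def]
    have A0: "1 + k1 s * (\<eta> * e 2 * mu j l 2 t w) / \<kappa> \<noteq> 0" if "t \<in> V" "w \<in> W" for t w
      using inverse_metric_11(1)[OF inU[OF that]] A[OF that] by simp
    have c: "\<epsilon> * \<kappa> ^ 3 * (6 - 4 / (1 + k1 s * (\<eta> * e 2 * mu j l 2 t w) / \<kappa>)) * (\<eta> * e i * mu j l i t w)
        - 2 * \<kappa>\<^sup>2 / (1 + k1 s * (\<eta> * e 2 * mu j l 2 t w) / \<kappa>)\<^sup>2 * (k1 s * (if i = 2 then e 2 else 0))
        = m (vector [s, t, w]) * (\<eta> * e i * mu j l i t w + lprod C (F i s))"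
      if "t \<in> V" "w \<in> W" "i \<in> {2, 3, 4}" for t w i
      using comp[OF inU[OF that(1,2)], of i] N_F[OF inU[OF that(1,2)] that(3)] that(3) s1
      by (auto simp: A[OF that(1,2)])
    have "k1 s = 0 \<and> lprod C (F 2 s) = 0 \<and> lprod C (F 3 s) = 0 \<and> lprod C (F 4 s) = 0 \<and>
        (\<exists>t\<in>V. \<exists>w\<in>W. m (vector [s, t, w]) = 2 * \<epsilon> * \<kappa> ^ 3)"
      using * A0 c[of _ _ 2] c[of _ _ 3] c[of _ _ 4] by (simp add: e_def)
    \<comment> \<open>This yields a point over \<open>s\<close> with nonzero \<open>m\<close>, where
      \<open>m\<close> can be cancelled from the first component.\<close>
    moreover have "2 * \<epsilon> * \<kappa> ^ 3 \<noteq> 0" using \<kappa> \<epsilon> by auto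
    ultimately show ?thesis using inU by (metis vector_3(1))
  qed
  obtain s where s: "s \<in> I" using assms(6) by blast
  then obtain p where p: "p \<in> U" "p $ 1 = s" "m p \<noteq> 0" using slice by blast
  \<comment> \<open>\<open>slice\<close> holds for every \<open>s\<close> in the interval, so the
    derivative of \<open>F 1\<close> vanishes identically.\<close>
  have "T_coeff p = 0" by (rule T_coeff_zero[OF p(1)]) (simp add: slice)
  with comp[OF p(1), of 1] N_F1[OF p(1)] slice[OF s] p have C1: "lprod C (F 1 s) = 0" by simp
  have "C = 0"
  proof (rule orthogonal_to_independent)
    fix a b c d
    assume z: "a *\<^sub>R F 1 s + b *\<^sub>R F 2 s + c *\<^sub>R F 3 s + d *\<^sub>R F 4 s = 0"
    have "lprod (a *\<^sub>R F 1 s + b *\<^sub>R F 2 s + c *\<^sub>R F 3 s + d *\<^sub>R F 4 s) (F i s) = 0" for i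
      unfolding z by (rule lprod.zero_left)
    from this[of 1] this[of 2] this[of 3] this[of 4] show "a = 0 \<and> b = 0 \<and> c = 0 \<and> d = 0"
      using F[OF s] by (auto simp: lprod.add_left lprod.scaleR_left e_def split: if_splits)
  qed (use C1 slice[OF s] in auto)
  with \<open>C \<noteq> 0\<close> show False by simp
qed

end
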